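(* Let $\ell\ge1$ and let $I\subset\{1,\dots,\ell\}$ be a non-empty set which is not of the form $\{\bar k,\bar k+1,\dots,\bar k+p\}$ for any $\bar k\in\{1,\dots,\ell\}$ and $p\ge0$. Consider the family of rational functions $$\lambda=-\frac{w_0\,Q_\ell(\mu;w_1,\dots,w_\ell)}{\sum_{i\in I}(-1)^if_i\,\mu^i},\qquad Q_\ell=1+(-1)^{\ell+1}\mu^{\ell+1}+\sum_{i=1}^\ell(-1)^iw_i\mu^i ,$$ obtained from $Q_\ell=0$ by the shift $w_i\mapsto w_i+f_i\lambda/w_0$, $i\in I$, with generic shift parameters $f_i$, normalised by $f_{\max I}=1$. Then the Saito metric $\eta$ of $(\lambda,\mathrm d\log\mu)$ on the parameter space of this family is degenerate.
   Context: Write $|I|=p+1$. The parameter space has dimension $\ell+1+p$, with coordinates $w_0\neq0$, $w_1,\dots,w_\ell$ and the $p$ parameters $f_i$, $i\in I\setminus\{\max I\}$ (equivalently, locally, $p$ of the non-zero roots of the denominator). For generic $f_i$ all poles of $\lambda$ away from $\mu=0,\infty$ are simple. The Saito metric is $\eta(X,Y)=-\sum_{q:\,\mathrm d\lambda(q)=0}\operatorname{Res}_q\dfrac{X(\lambda)\,Y(\lambda)\,\phi^2}{\mathrm d\lambda}$ with $\phi=\mathrm d\log\mu$, where the sum is over critical points of $\mu\mapsto\lambda$ and $X(\lambda),Y(\lambda)$ are derivatives along the parameter space at fixed $\mu$. Degenerate means that its Gram matrix has zero determinant. *)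

theory Defs
  imports "HOL-Complex_Analysis.Complex_Analysis" "Jordan_Normal_Form.Determinant"
begin

text \<open>Coordinates on the parameter space: \<open>W i\<close> is \<open>w\<^sub>i\<close> (\<open>0 \<le> i \<le> l\<close>) and \<open>F i\<close> is \<open>f\<^sub>i\<close>
  (\<open>i \<in> I - {Max I}\<close>).  Points and tangent vectors are both functions \<open>coord \<Rightarrow> complex\<close>; their
  values outside \<open>coords l I\<close> never enter.\<close>

datatype coord = W nat | F nat

definition coords :: "nat \<Rightarrow> nat set \<Rightarrow> coord list" where
  "coords l I = map W [0..<Suc l] @ map F (sorted_list_of_set (I - {Max I}))"

definition shift_param :: "nat set \<Rightarrow> (coord \<Rightarrow> complex) \<Rightarrow> nat \<Rightarrow> complex" where
  "shift_param I x i = (if i = Max I then 1 else x (F i))"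

definition Q :: "nat \<Rightarrow> (nat \<Rightarrow> complex) \<Rightarrow> complex \<Rightarrow> complex" where
  "Q l w \<mu> = 1 + (-1) ^ (l + 1) * \<mu> ^ (l + 1) + (\<Sum>i=1..l. (-1) ^ i * w i * \<mu> ^ i)"

definition den :: "nat set \<Rightarrow> (coord \<Rightarrow> complex) \<Rightarrow> complex \<Rightarrow> complex" where
  "den I x \<mu> = (\<Sum>i\<in>I. (-1) ^ i * shift_param I x i * \<mu> ^ i)"

definition lam :: "nat \<Rightarrow> nat set \<Rightarrow> (coord \<Rightarrow> complex) \<Rightarrow> complex \<Rightarrow> complex" where
  "lam l I x \<mu> = - (x (W 0) * Q l (\<lambda>i. x (W i)) \<mu>) / den I x \<mu>"

text \<open>\<open>lam\<close> is the solution of \<open>Q = 0\<close> after the shift \<open>w\<^sub>i \<mapsto> w\<^sub>i + f\<^sub>i \<lambda> / w\<^sub>0\<close>, \<open>i \<in> I\<close>.\<close>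

lemma Q_shift_eq_0_iff:
  assumes "I \<subseteq> {1..l}" "x (W 0) \<noteq> 0" "den I x \<mu> \<noteq> 0"
  shows "Q l (\<lambda>i. x (W i) + (if i \<in> I then shift_param I x i * z / x (W 0) else 0)) \<mu> = 0
           \<longleftrightarrow> z = lam l I x \<mu>"
proof -
  have "(\<Sum>i=1..l. (-1) ^ i * (if i \<in> I then shift_param I x i * z / x (W 0) else 0) * \<mu> ^ i)
      = (\<Sum>i\<in>I. (-1) ^ i * (shift_param I x i * z / x (W 0)) * \<mu> ^ i)"
    using assms(1) by (intro sum.mono_neutral_cong_right) auto
  also have "\<dots> = z / x (W 0) * den I x \<mu>"
    unfolding den_def sum_distrib_left by (intro sum.cong) auto
  finally have "Q l (\<lambda>i. x (W i) + (if i \<in> I then shift_param I x i * z / x (W 0) else 0)) \<mu>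
      = Q l (\<lambda>i. x (W i)) \<mu> + z / x (W 0) * den I x \<mu>"
    unfolding Q_def by (simp add: algebra_simps sum.distrib)
  then show ?thesis
    using assms(2,3) unfolding lam_def by (auto simp: field_simps eq_neg_iff_add_eq_0)
qed

text \<open>Genericity of the shift parameters, as explicit non-empty Zariski-open conditions on the
  \<open>f\<^sub>i\<close> for each given \<open>w\<close>: the denominator really starts at \<open>\<mu> ^ Min I\<close>, and each of its
  non-zero roots is simple and is not cancelled by a root of the numerator.  In other words, the
  denominator has \<open>Max I - Min I\<close> distinct non-zero roots and \<open>\<lambda>\<close> has a simple pole at each.\<close>

definition generic :: "nat \<Rightarrow> nat set \<Rightarrow> (coord \<Rightarrow> complex) \<Rightarrow> bool" where
  "generic l I x \<longleftrightarrow>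
     shift_param I x (Min I) \<noteq> 0 \<and>
     (\<forall>\<mu>. \<mu> \<noteq> 0 \<and> den I x \<mu> = 0 \<longrightarrow>
        deriv (den I x) \<mu> \<noteq> 0 \<and> Q l (\<lambda>i. x (W i)) \<mu> \<noteq> 0)"

definition tangent_deriv ::
    "nat \<Rightarrow> nat set \<Rightarrow> (coord \<Rightarrow> complex) \<Rightarrow> (coord \<Rightarrow> complex) \<Rightarrow> complex \<Rightarrow> complex" where
  "tangent_deriv l I x X \<mu> = deriv (\<lambda>t. lam l I (\<lambda>a. x a + t * X a) \<mu>) 0"

text \<open>The points \<open>\<mu> = 0\<close> and \<open>\<mu> = \<infinity>\<close> are poles of \<open>\<lambda>\<close> when \<open>I \<subseteq> {1..l}\<close>, so they are
  not critical points; the other poles are excluded because HOL division gives \<open>lam\<close> the junk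
  value 0 there.\<close>

definition critical_points :: "nat \<Rightarrow> nat set \<Rightarrow> (coord \<Rightarrow> complex) \<Rightarrow> complex set" where
  "critical_points l I x = {q. q \<noteq> 0 \<and> den I x q \<noteq> 0 \<and> deriv (lam l I x) q = 0}"

text \<open>With \<open>\<phi> = d\<mu> / \<mu>\<close> and \<open>d\<lambda> = \<lambda>' d\<mu>\<close>, the differential
  \<open>X(\<lambda>) Y(\<lambda>) \<phi>\<^sup>2 / d\<lambda>\<close> is \<open>X(\<lambda>) Y(\<lambda>) / (\<mu>\<^sup>2 \<lambda>') d\<mu>\<close>.\<close>

definition saito_metric ::
    "nat \<Rightarrow> nat set \<Rightarrow> (coord \<Rightarrow> complex) \<Rightarrow> (coord \<Rightarrow> complex) \<Rightarrow> (coord \<Rightarrow> complex) \<Rightarrow> complex" where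
  "saito_metric l I x X Y =
     - (\<Sum>q\<in>critical_points l I x.
          residue (\<lambda>\<mu>. tangent_deriv l I x X \<mu> * tangent_deriv l I x Y \<mu> * (1 / \<mu>)\<^sup>2
                        / deriv (lam l I x) \<mu>) q)"

definition coord_vector :: "coord \<Rightarrow> coord \<Rightarrow> complex" where
  "coord_vector a b = (if b = a then 1 else 0)"

definition gram_matrix :: "nat \<Rightarrow> nat set \<Rightarrow> (coord \<Rightarrow> complex) \<Rightarrow> complex mat" where
  "gram_matrix l I x =
     mat (length (coords l I)) (length (coords l I))
       (\<lambda>(i, j). saito_metric l I x (coord_vector (coords l I ! i)) (coord_vector (coords l I ! j)))"

end

theory Submission
  imports Defs
begin

text \<open>Let \<open>a = Min I\<close>, \<open>b = Max I\<close>. In the directions \<open>w\<^sub>i\<close>, \<open>w\<^sub>j\<close> with \<open>a \<le> i \<le> b\<close> and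
  \<open>1 \<le> j \<le> l\<close> the form defining \<open>\<eta>\<close> is a multiple of \<open>\<mu> ^ (i + j - 1 - a) / P d\<mu>\<close>, where \<open>P\<close> is a
  polynomial of degree \<open>l + 1 + b - a\<close> whose zeros are exactly the critical points. It is regular
  at infinity, so its residues sum to zero. The Gram matrix therefore has a zero block of size
  \<open>(b - a + 1) \<times> l\<close>. As \<open>I\<close> has a gap, the order \<open>l + |I|\<close> of the matrix is less than
  \<open>(b - a + 1) + l\<close>, so every term of the Leibniz expansion contains an entry of that block.\<close>

section \<open>Determinants with a large zero block\<close>

text \<open>Pigeonhole, as in the easy half of the Frobenius-Koenig theorem: a permutation carries
  \<open>R\<close> to a set of the same size, and by \<open>card\<close> this image cannot be
  disjoint from \<open>C\<close> inside \<open>{..<n}\<close>.\<close>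

lemma det_zero_block:
  fixes A :: "'a :: comm_ring_1 mat"
  assumes A: "A \<in> carrier_mat n n" and R: "R \<subseteq> {..<n}" and C: "C \<subseteq> {..<n}"
    and zero: "\<And>i j. i \<in> R \<Longrightarrow> j \<in> C \<Longrightarrow> A $$ (i, j) = 0"
    and card: "n < card R + card C"
  shows "Determinant.det A = 0"
proof -
  have "(\<Prod>i = 0..<n. A $$ (i, p i)) = 0" if p: "p permutes {0..<n}" for p
  proof -
    have fin: "finite R" "finite C" using R C by (auto intro: finite_subset)
    have "p ` R \<subseteq> {..<n}"
      using R permutes_in_image[OF p] by auto
    moreover have "card (p ` R) = card R"
      using permutes_inj[OF p] by (intro card_image) (auto simp: inj_on_def)
    moreover have "card (p ` R \<union> C) \<le> n" using calculation C
      by (metis Un_least card_lessThan card_mono finite_lessThan)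
    ultimately have "p ` R \<inter> C \<noteq> {}"
      using card fin card_Un_disjoint[of "p ` R" C] by (metis finite_imageI leD)
    then obtain i where "i \<in> R" "p i \<in> C" by blast
    then show ?thesis
      using R zero by (intro prod_zero) (auto intro!: bexI[of _ i])
  qed
  then show ?thesis
    using A by (simp add: Determinant.det_def)
qed

section \<open>Residue sum of a rational function\<close>

text \<open>The degree gap makes the function o(1/z) at infinity, so its integral over a circle
  around all zeros of \<open>p\<close> tends to 0 as the radius grows; by the residue theorem that
  integral is \<open>2 * pi * \<i>\<close> times the sum.\<close>

lemma sum_residues_rational_eq_0:
  fixes s p :: "complex poly"
  assumes deg: "degree s + 2 \<le> degree p"
  shows "(\<Sum>q | poly p q = 0. residue (\<lambda>z. poly s z / poly p z) q) = 0"
proof -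
  define Z where "Z = {q. poly p q = 0}"
  define f where "f = (\<lambda>z. poly s z / poly p z)"
  have "p \<noteq> 0" using deg by auto
  then have fin: "finite Z" unfolding Z_def by (rule poly_roots_finite)
  have hol: "f holomorphic_on UNIV - Z"
    unfolding f_def Z_def by (intro holomorphic_intros) auto
  have "degree (pCons 0 s) < degree p"
    using deg by (auto intro: le_less_trans[OF degree_pCons_le])
  then have "((\<lambda>z. poly (pCons 0 s) z / poly p z) \<longlongrightarrow> 0) at_infinity"
    by (rule poly_divide_tendsto_0_at_infinity)
  then have lim: "((\<lambda>z. z * f z) \<longlongrightarrow> 0) at_infinity"
    by (simp add: f_def)
  have "norm (\<Sum>q\<in>Z. residue f q) \<le> e" if "e > 0" for e
  proof -
    have "eventually (\<lambda>z. norm (z * f z) < e) at_infinity"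
      using tendstoD[OF lim \<open>e > 0\<close>] by simp
    then obtain B where B: "\<And>z. norm z \<ge> B \<Longrightarrow> norm (z * f z) < e"
      unfolding eventually_at_infinity by blast
    obtain M where M: "\<And>z. z \<in> Z \<Longrightarrow> norm z \<le> M"
      using finite_imp_bounded[OF fin] unfolding bounded_iff by blast
    \<comment> \<open>The circle must enclose \<open>Z\<close> and lie where
      \<open>norm (z * f z) < e\<close>; \<open>max M 0\<close> keeps the radius positive.\<close>
    define r where "r = max B (max M 0) + 1"
    have r: "r > 0" "r \<ge> B" "r > M" unfolding r_def by auto
    have off: "path_image (circlepath 0 r) \<subseteq> UNIV - Z"
    proof -
      have "z \<notin> Z" if "norm z = r" for z using M[of z] r that by linarith
      then show ?thesis using r by (auto simp: dist_norm)
    qed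
    have inside: "winding_number (circlepath 0 r) q = 1" if "q \<in> Z" for q
      using M[OF that] r by (intro winding_number_circlepath) auto
    have ci: "contour_integral (circlepath 0 r) f = 2 * pi * \<i> * (\<Sum>q\<in>Z. residue f q)"
      using Residue_theorem[OF open_UNIV connected_UNIV fin hol valid_path_circlepath _ off]
      by (simp add: inside)
    have "f contour_integrable_on circlepath 0 r"
      by (rule contour_integrable_holomorphic_simple[OF hol _ valid_path_circlepath off])
         (simp add: open_Diff finite_imp_closed fin)
    then have "(f has_contour_integral contour_integral (circlepath 0 r) f) (circlepath 0 r)"
      by (rule has_contour_integral_integral)
    \<comment> \<open>The radius cancels: the bound is \<open>2 * pi * e\<close>, and the factor
      \<open>2 * pi\<close> is divided out at the end.\<close>
    then have "norm (contour_integral (circlepath 0 r) f) \<le> e / r * (2 * pi * r)"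
    proof (rule has_contour_integral_bound_circlepath)
      fix z :: complex assume "norm (z - 0) = r"
      then have "r * norm (f z) \<le> e"
        using B[of z] r by (simp add: norm_mult)
      then show "norm (f z) \<le> e / r"
        using r by (simp add: pos_le_divide_eq mult.commute)
    qed (use \<open>e > 0\<close> r in auto)
    then show ?thesis
      using r by (simp add: ci norm_mult)
  qed
  then have "norm (\<Sum>q\<in>Z. residue f q) \<le> 0"
    by (rule field_le_epsilon) simp
  then show ?thesis unfolding Z_def f_def by simp
qed

section \<open>Polynomials behind \<lambda> and its derivative\<close>

context
  fixes l :: nat and I :: "nat set" and x :: "coord \<Rightarrow> complex"
begin

definition num_poly :: "complex poly" where
  "num_poly = 1 + monom ((-1) ^ (l + 1)) (l + 1) + (\<Sum>i=1..l. monom ((-1) ^ i * x (W i)) i)"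

text \<open>With \<open>\<mu> ^ Min I\<close> split off, genericity makes the constant term nonzero,
  which keeps 0 from being a zero of \<open>crit_poly\<close>.\<close>

definition den_poly :: "complex poly" where
  "den_poly = (\<Sum>i\<in>I. monom ((-1) ^ i * shift_param I x i) (i - Min I))"

text \<open>Up to the factor \<open>- w\<^sub>0 \<mu> ^ (Min I - 1)\<close>, the numerator of \<open>\<lambda>'\<close> over the square of the
  denominator of \<open>\<lambda>\<close>.\<close>

definition crit_poly :: "complex poly" where
  "crit_poly = pCons 0 (pderiv num_poly * den_poly - num_poly * pderiv den_poly)
     - Polynomial.smult (of_nat (Min I)) (num_poly * den_poly)"

lemma poly_num: "poly num_poly \<mu> = Q l (\<lambda>i. x (W i)) \<mu>"
  by (simp add: num_poly_def Q_def poly_monom poly_sum)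

lemma coeff_num: "coeff num_poly k = (if k = 0 then 1 else 0) + (if k = l + 1 then (-1) ^ (l + 1) else 0)
    + (if k \<in> {1..l} then (-1) ^ k * x (W k) else 0)"
  by (simp add: num_poly_def coeff_sum sum.delta)

lemma degree_num: "degree num_poly = l + 1"
proof (rule antisym)
  show "degree num_poly \<le> l + 1" by (rule degree_le) (simp add: coeff_num)
  show "l + 1 \<le> degree num_poly" by (rule le_degree) (simp add: coeff_num)
qed

context
  assumes I: "I \<subseteq> {1..l}" "I \<noteq> {}"
begin

lemma finite_I: "finite I"
  using I finite_subset by blast

lemma Min_I: "Min I \<in> I" "1 \<le> Min I" "Min I \<le> Max I" and Max_I: "Max I \<in> I" "Max I \<le> l"
proof -
  show *: "Min I \<in> I" "Max I \<in> I" using finite_I I by auto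
  then show "1 \<le> Min I" "Max I \<le> l" using I by auto
  show "Min I \<le> Max I" using * finite_I by auto
qed

lemma den_eq: "den I x \<mu> = \<mu> ^ Min I * poly den_poly \<mu>"
proof -
  have "\<mu> ^ i = \<mu> ^ Min I * \<mu> ^ (i - Min I)" if "i \<in> I" for i
    using that finite_I by (simp flip: power_add)
  then show ?thesis
    by (simp add: den_def den_poly_def poly_sum poly_monom sum_distrib_left mult_ac cong: sum.cong)
qed

lemma coeff_den:
  "coeff den_poly k = (if k + Min I \<in> I then (-1) ^ (k + Min I) * shift_param I x (k + Min I) else 0)"
proof -
  have "i - Min I = k \<longleftrightarrow> i = k + Min I" if "i \<in> I" for i
    using that finite_I by (auto simp: le_imp_diff_is_add)
  then show ?thesis
    using finite_I by (simp add: den_poly_def coeff_sum sum.delta' cong: sum.cong)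
qed

lemma degree_den: "degree den_poly = Max I - Min I"
proof (rule antisym)
  show "degree den_poly \<le> Max I - Min I"
  proof (rule degree_le, intro allI impI)
    fix k assume "Max I - Min I < k"
    then have "k + Min I \<notin> I" using Max_ge[OF finite_I, of "k + Min I"] by linarith
    then show "coeff den_poly k = 0" by (simp add: coeff_den)
  qed
  show "Max I - Min I \<le> degree den_poly"
    using Min_I Max_I by (intro le_degree) (simp add: coeff_den shift_param_def)
qed

text \<open>The only danger is cancellation at the top. The leading coefficient is
  \<open>l + 1 - Max I\<close> times the product of those of \<open>num_poly\<close> and
  \<open>den_poly\<close>, and \<open>Max I \<le> l\<close>.\<close>

lemma degree_crit: "degree crit_poly = l + 1 + Max I - Min I"
proof -
  define N where "N = degree num_poly + degree den_poly"
  define c where "c = lead_coeff num_poly * lead_coeff den_poly"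
  \<comment> \<open>The Euler operator f \<mapsto> z f' multiplies the top coefficient by the
    degree. Constants are treated apart because their derivative is 0.\<close>
  have top: "degree (pCons 0 (pderiv f * g)) \<le> degree f + degree g"
      "coeff (pCons 0 (pderiv f * g)) (degree f + degree g)
        = of_nat (degree f) * (lead_coeff f * lead_coeff g)" for f g :: "complex poly"
  proof -
    show "degree (pCons 0 (pderiv f * g)) \<le> degree f + degree g"
    proof (cases "degree f")
      case 0
      then have "pderiv f = 0" by (simp add: pderiv_eq_0_iff)
      then show ?thesis by simp
    next
      case (Suc n)
      then have "degree (pderiv f) = n" by (simp add: degree_pderiv)
      then have "degree (pderiv f * g) \<le> n + degree g"
        using degree_mult_le[of "pderiv f" g] by simp
      then show ?thesis
        using degree_pCons_le[of 0 "pderiv f * g"] Suc by linarith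
    qed
    show "coeff (pCons 0 (pderiv f * g)) (degree f + degree g)
        = of_nat (degree f) * (lead_coeff f * lead_coeff g)"
    proof (cases "degree f")
      case 0
      then have "pderiv f = 0" by (simp add: pderiv_eq_0_iff)
      then show ?thesis using 0 by simp
    next
      case (Suc n)
      then have "degree (pderiv f) = n" by (simp add: degree_pderiv)
      then show ?thesis
        using coeff_mult_degree_sum[of "pderiv f" g] Suc by (simp add: coeff_pderiv algebra_simps)
    qed
  qed
  have crit: "crit_poly = pCons 0 (pderiv num_poly * den_poly) - pCons 0 (pderiv den_poly * num_poly)
      - Polynomial.smult (of_nat (Min I)) (num_poly * den_poly)"
    by (simp add: crit_poly_def mult.commute)
  have num_den: "lead_coeff den_poly * lead_coeff num_poly = c"
    "degree den_poly + degree num_poly = N"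
    by (simp_all add: c_def N_def)
  have "coeff crit_poly N
      = of_nat (degree num_poly) * c - of_nat (degree den_poly) * c - of_nat (Min I) * c"
    using top(2)[of num_poly den_poly] top(2)[of den_poly num_poly]
      coeff_mult_degree_sum[of num_poly den_poly]
    unfolding crit coeff_diff coeff_smult num_den N_def[symmetric] c_def[symmetric] by simp
  also have "\<dots> = (of_nat (degree num_poly) - of_nat (degree den_poly + Min I)) * c"
    by (simp add: algebra_simps)
  also have "degree den_poly + Min I = Max I"
    using Min_I by (simp add: degree_den)
  finally have "coeff crit_poly N = (of_nat (degree num_poly) - of_nat (Max I)) * c" .
  moreover have "num_poly \<noteq> 0" using degree_num by auto
  moreover have "coeff den_poly (Max I - Min I) \<noteq> 0"
    using Min_I Max_I by (simp add: coeff_den shift_param_def)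
  then have "den_poly \<noteq> 0" by auto
  moreover have "of_nat (degree num_poly) \<noteq> (of_nat (Max I) :: complex)"
    unfolding of_nat_eq_iff degree_num using Max_I by simp
  ultimately have "coeff crit_poly N \<noteq> 0"
    by (simp add: c_def)
  moreover have "degree crit_poly \<le> N"
    unfolding crit
  proof (intro degree_diff_le)
    show "degree (Polynomial.smult (of_nat (Min I)) (num_poly * den_poly)) \<le> N"
      using degree_smult_le degree_mult_le unfolding N_def by (rule order_trans)
  qed (use top(1)[of num_poly den_poly] top(1)[of den_poly num_poly] in \<open>simp_all add: N_def add.commute\<close>)
  ultimately have "degree crit_poly = N"
    by (metis le_antisym le_degree)
  then show ?thesis using Min_I by (simp add: N_def degree_num degree_den)
qed

lemma deriv_lam:
  assumes "\<mu> \<noteq> 0" "den I x \<mu> \<noteq> 0"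
  shows "deriv (lam l I x) \<mu> = - x (W 0) * \<mu> ^ (Min I - 1) * poly crit_poly \<mu> / (den I x \<mu>)\<^sup>2"
proof -
  define n d where "n = poly num_poly \<mu>" and "d = poly den_poly \<mu>"
  define n' d' where "n' = poly (pderiv num_poly) \<mu>" and "d' = poly (pderiv den_poly) \<mu>"
  \<comment> \<open>Makes \<open>Min I - 1\<close> a genuine predecessor, so that
    \<open>\<mu> ^ m\<close> can be factored out of the quotient rule.\<close>
  obtain m where m: "Min I = Suc m" using Min_I by (cases "Min I") auto
  have lam: "lam l I x = (\<lambda>\<mu>. - (x (W 0) * poly num_poly \<mu>) / (\<mu> ^ Min I * poly den_poly \<mu>))"
    by (simp add: lam_def den_eq poly_num fun_eq_iff)
  have "((\<lambda>\<mu>. - (x (W 0) * poly num_poly \<mu>)) has_field_derivative - (x (W 0) * n')) (at \<mu>)"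
    unfolding n'_def by (auto intro!: derivative_eq_intros)
  moreover have "((\<lambda>\<mu>. \<mu> ^ Min I * poly den_poly \<mu>) has_field_derivative
      of_nat (Min I) * \<mu> ^ (Min I - 1) * d + \<mu> ^ Min I * d') (at \<mu>)"
    unfolding d_def d'_def by (auto intro!: derivative_eq_intros)
  moreover have "\<mu> ^ Min I * poly den_poly \<mu> \<noteq> 0"
    using assms by (simp add: den_eq)
  ultimately have "deriv (lam l I x) \<mu> =
      (- (x (W 0) * n') * (\<mu> ^ Min I * d)
        - (- (x (W 0) * n)) * (of_nat (Min I) * \<mu> ^ (Min I - 1) * d + \<mu> ^ Min I * d'))
       / ((\<mu> ^ Min I * d) * (\<mu> ^ Min I * d))"
    unfolding lam n_def d_def by (intro DERIV_imp_deriv DERIV_divide)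
  also have "\<dots> = - x (W 0) * \<mu> ^ (Min I - 1) * poly crit_poly \<mu> / (den I x \<mu>)\<^sup>2"
    by (simp add: den_eq power2_eq_square crit_poly_def m n_def d_def n'_def d'_def algebra_simps)
  finally show ?thesis .
qed

section \<open>Tangent directions, critical points and vanishing metric entries\<close>

text \<open>For \<open>j \<ge> 1\<close> the coordinate \<open>W j\<close> enters \<lambda> affinely
  and only through the numerator.\<close>

lemma tangent_deriv_W:
  assumes "j \<in> {1..l}"
  shows "tangent_deriv l I x (coord_vector (W j)) \<mu> = - x (W 0) * (-1) ^ j * \<mu> ^ j / den I x \<mu>"
proof -
  have shift: "lam l I (\<lambda>a. x a + t * coord_vector (W j) a) \<mu>
      = - (x (W 0) * (Q l (\<lambda>i. x (W i)) \<mu> + t * (-1) ^ j * \<mu> ^ j)) / den I x \<mu>" for t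
  proof -
    have "(\<Sum>i=1..l. (-1) ^ i * (x (W i) + t * coord_vector (W j) (W i)) * \<mu> ^ i)
        = (\<Sum>i=1..l. (-1) ^ i * x (W i) * \<mu> ^ i + (if i = j then t * (-1) ^ j * \<mu> ^ j else 0))"
      by (intro sum.cong) (auto simp: coord_vector_def algebra_simps)
    then have "Q l (\<lambda>i. x (W i) + t * coord_vector (W j) (W i)) \<mu>
        = Q l (\<lambda>i. x (W i)) \<mu> + t * (-1) ^ j * \<mu> ^ j"
      using assms by (simp add: Q_def sum.distrib)
    moreover have "den I (\<lambda>a. x a + t * coord_vector (W j) a) \<mu> = den I x \<mu>"
      by (simp add: den_def shift_param_def coord_vector_def cong: if_cong)
    ultimately show ?thesis
      using assms by (simp add: lam_def coord_vector_def)
  qed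
  \<comment> \<open>As a product with a constant inverse, the quotient needs no condition on
    \<open>den I x \<mu>\<close>; where it is 0, both sides are 0.\<close>
  show ?thesis unfolding tangent_deriv_def shift divide_inverse
    by (rule DERIV_imp_deriv) (auto intro!: derivative_eq_intros)
qed

context
  assumes W0: "x (W 0) \<noteq> 0" and gen: "generic l I x"
begin

text \<open>Genericity enters here: the residue theorem sums over all zeros of
  \<open>crit_poly\<close>, so none may lie at 0 or at another pole of \<lambda>.\<close>

lemma crit_poly_eq_0_iff: "poly crit_poly \<mu> = 0 \<longleftrightarrow> \<mu> \<in> critical_points l I x"
proof -
  consider "\<mu> = 0" | "\<mu> \<noteq> 0" "den I x \<mu> = 0" | "\<mu> \<noteq> 0" "den I x \<mu> \<noteq> 0" by blast
  then show ?thesis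
  proof cases
    case 1
    have "poly num_poly 0 = 1" by (simp add: poly_0_coeff_0 coeff_num)
    moreover have "poly den_poly 0 \<noteq> 0"
      using gen Min_I by (simp add: poly_0_coeff_0 coeff_den generic_def)
    ultimately show ?thesis
      using 1 Min_I by (simp add: critical_points_def crit_poly_def)
  next
    case 2
    then have d: "poly den_poly \<mu> = 0" by (simp add: den_eq)
    have "((\<lambda>\<mu>. \<mu> ^ Min I * poly den_poly \<mu>) has_field_derivative
        \<mu> ^ Min I * poly (pderiv den_poly) \<mu>) (at \<mu>)"
      using d by (auto intro!: derivative_eq_intros)
    then have "deriv (den I x) \<mu> = \<mu> ^ Min I * poly (pderiv den_poly) \<mu>"
      unfolding den_eq[abs_def] by (rule DERIV_imp_deriv)
    moreover have "deriv (den I x) \<mu> \<noteq> 0" "poly num_poly \<mu> \<noteq> 0"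
      using gen 2 unfolding generic_def poly_num by blast+
    \<comment> \<open>At a root of \<open>den_poly\<close> only
      \<open>- \<mu> * poly num_poly \<mu> * poly (pderiv den_poly) \<mu>\<close> survives.\<close>
    ultimately have "poly crit_poly \<mu> \<noteq> 0"
      using 2 d by (simp add: crit_poly_def)
    then show ?thesis
      using 2 by (simp add: critical_points_def)
  next
    case 3
    then show ?thesis using W0 deriv_lam[OF 3] by (simp add: critical_points_def)
  qed
qed

lemma saito_metric_W_eq_0:
  assumes i: "i \<in> {Min I..Max I}" and j: "j \<in> {1..l}"
  shows "saito_metric l I x (coord_vector (W i)) (coord_vector (W j)) = 0"
proof -
  \<comment> \<open>The tangent vectors give \<open>i + j\<close>, \<open>\<phi>\<^sup>2\<close>
    takes away 2 and the derivative of \<lambda> takes away \<open>Min I - 1\<close>. The lower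
    bounds on \<open>i\<close> and \<open>j\<close> make the subtraction exact, so there is no pole
    at 0.\<close>
  define e where "e = i + j - 1 - Min I"
  define s where "s = monom (- x (W 0) * (-1) ^ (i + j)) e"
  have i': "i \<in> {1..l}" using i Min_I Max_I by auto
  have res: "residue (\<lambda>\<mu>. tangent_deriv l I x (coord_vector (W i)) \<mu>
        * tangent_deriv l I x (coord_vector (W j)) \<mu> * (1 / \<mu>)\<^sup>2 / deriv (lam l I x) \<mu>) q
      = residue (\<lambda>\<mu>. poly s \<mu> / poly crit_poly \<mu>) q"
    if q: "q \<in> critical_points l I x" for q
  proof (rule residue_cong)
    have "continuous_on UNIV (den I x)"
      unfolding den_def by (intro continuous_intros)
    then have "open {\<mu>. den I x \<mu> \<noteq> 0}" by (intro open_Collect_neq) auto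
    then have "open ({\<mu>. den I x \<mu> \<noteq> 0} - {0})" by (rule open_delete)
    then have "eventually (\<lambda>\<mu>. \<mu> \<in> {\<mu>. den I x \<mu> \<noteq> 0} - {0}) (nhds q)"
      using q by (intro eventually_nhds_in_open) (auto simp: critical_points_def)
    then have "eventually (\<lambda>\<mu>. \<mu> \<in> {\<mu>. den I x \<mu> \<noteq> 0} - {0}) (at q)"
      by (rule eventually_nhds_conv_at[THEN iffD1, THEN conjunct1])
    then show "eventually (\<lambda>\<mu>. tangent_deriv l I x (coord_vector (W i)) \<mu>
        * tangent_deriv l I x (coord_vector (W j)) \<mu> * (1 / \<mu>)\<^sup>2 / deriv (lam l I x) \<mu>
        = poly s \<mu> / poly crit_poly \<mu>) (at q)"
    proof (rule eventually_mono)
      fix \<mu> assume "\<mu> \<in> {\<mu>. den I x \<mu> \<noteq> 0} - {0}"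
      then have nz: "\<mu> \<noteq> 0" "den I x \<mu> \<noteq> 0" by auto
      have exp: "i + j = e + 2 + (Min I - 1)" using i j Min_I by (auto simp: e_def)
      then have pow: "\<mu> ^ i * \<mu> ^ j = \<mu> ^ e * \<mu>\<^sup>2 * \<mu> ^ (Min I - 1)"
        by (simp only: power_add[symmetric] exp)
      have "tangent_deriv l I x (coord_vector (W i)) \<mu>
          * tangent_deriv l I x (coord_vector (W j)) \<mu> * (1 / \<mu>)\<^sup>2 / deriv (lam l I x) \<mu>
        = ((x (W 0))\<^sup>2 * (-1) ^ (i + j) * (\<mu> ^ i * \<mu> ^ j) / (den I x \<mu>)\<^sup>2 / \<mu>\<^sup>2)
          / (- x (W 0) * \<mu> ^ (Min I - 1) * poly crit_poly \<mu> / (den I x \<mu>)\<^sup>2)"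
        unfolding tangent_deriv_W[OF i'] tangent_deriv_W[OF j] deriv_lam[OF nz]
        by (simp add: power_add power2_eq_square mult_ac)
      also have "\<dots> = - x (W 0) * (-1) ^ (i + j) * \<mu> ^ e / poly crit_poly \<mu>"
        unfolding pow using nz W0 by (simp add: power2_eq_square)
      finally show "tangent_deriv l I x (coord_vector (W i)) \<mu>
          * tangent_deriv l I x (coord_vector (W j)) \<mu> * (1 / \<mu>)\<^sup>2 / deriv (lam l I x) \<mu>
          = poly s \<mu> / poly crit_poly \<mu>"
        by (simp add: s_def poly_monom)
    qed
  qed simp
  have "degree s \<le> e" unfolding s_def by (rule degree_monom_le)
  \<comment> \<open>Sharp at \<open>i = Max I\<close>, \<open>j = l\<close>: this is where the upper
    bounds matter.\<close>
  also have "e + 2 \<le> degree crit_poly"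
    using i j Min_I Max_I by (auto simp: degree_crit e_def)
  finally have "(\<Sum>q | poly crit_poly q = 0. residue (\<lambda>\<mu>. poly s \<mu> / poly crit_poly \<mu>) q) = 0"
    by (intro sum_residues_rational_eq_0) simp
  then show ?thesis
    by (simp add: saito_metric_def res crit_poly_eq_0_iff cong: sum.cong)
qed

end

end

end

theorem proposition3p4:
  fixes l :: nat and I :: "nat set" and x :: "coord \<Rightarrow> complex"
  assumes "l \<ge> 1"
    and "I \<subseteq> {1..l}" and "I \<noteq> {}"
    and "\<not> (\<exists>k\<in>{1..l}. \<exists>p::nat. I = {k..k + p})"
    and "x (W 0) \<noteq> 0"
    and "generic l I x"
  shows "Determinant.det (gram_matrix l I x) = 0"
proof -
  note I = assms(2,3)
  note fin = finite_I[OF I]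
  note m = Min_I[OF I] Max_I[OF I]
  let ?n = "length (coords l I)"
  \<comment> \<open>There are \<open>l + 1\<close> coordinates \<open>W i\<close> and
    \<open>card I - 1\<close> coordinates \<open>F i\<close>, since the parameter at
    \<open>Max I\<close> is normalised.\<close>
  have n: "?n = l + card I"
    using fin m by (simp add: coords_def card_Diff_singleton card_gt_0_iff I)
  have sub: "I \<subseteq> {Min I..Max I}" using fin by auto
  moreover have "I \<noteq> {Min I..Max I}"
  proof
    assume "I = {Min I..Max I}"
    then have "I = {Min I..Min I + (Max I - Min I)}" using m by simp
    moreover have "Min I \<in> {1..l}" using m by simp
    ultimately show False using assms(4) by blast
  qed
  ultimately have "card I < card {Min I..Max I}" by (intro psubset_card_mono) auto
  then have card: "?n < card {Min I..Max I} + card {1..l}" by (simp add: n)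
  have "card I \<ge> 1" using fin I by (simp add: Suc_le_eq card_gt_0_iff)
  then have le: "{Min I..Max I} \<subseteq> {..<?n}" "{1..l} \<subseteq> {..<?n}" using m by (auto simp: n)
  \<comment> \<open>As the list starts with \<open>W 0\<close>, matrix index and coordinate index
    agree, and the two index ranges serve directly as rows and columns of the block.\<close>
  have W: "coords l I ! i = W i" if "i \<le> l" for i
    using that by (simp add: coords_def nth_append del: upt_Suc)
  show ?thesis
  proof (rule det_zero_block[OF _ le _ card])
    show "gram_matrix l I x \<in> carrier_mat ?n ?n" by (simp add: gram_matrix_def)
    fix i j assume ij: "i \<in> {Min I..Max I}" "j \<in> {1..l}"
    then have "i < ?n" "j < ?n" using le by auto
    then show "gram_matrix l I x $$ (i, j) = 0"
      using saito_metric_W_eq_0[OF I assms(5,6) ij] ij m by (simp add: gram_matrix_def W)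
  qed
qed

end
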